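(* Let $f$ satisfy Assumption C and $(\xi_n)$ satisfy the noise assumption (see context). Put $L_0:=-f'(K)$ and $\alpha_0:=\dfrac{-f'(K)-1}{-f'(K)+1}$. Suppose that the distribution of the $\xi_n$ is symmetric around zero and is either continuous (with a probability density) or discrete with a countable number of states. Then there exist $\alpha\in(0,\alpha_0)$ and $\ell\in\bigl(\alpha_0-\alpha,\min\{\alpha,1-\alpha\}\bigr)$ such that $$\alpha_0<\alpha+\ell<\frac{L_0}{L_0+1}\qquad\text{and}\qquad \mathbb E\ln\bigl[(1-\alpha-\ell\xi)L_0-\alpha-\ell\xi\bigr]<0,$$ where $\xi$ has the common distribution of the $\xi_n$.
   Context: Noise assumption: $(\xi_n)_{n\in\mathbb N}$ is a sequence of independent identically distributed random variables on a probability space $(\Omega,\mathcal F,\mathbb P)$ with $|\xi_n|\le1$ for all $n$, and $\mathbb P\{\xi_n\in(1-\varepsilon,1]\}>0$ for each $\varepsilon>0$. Assumption C on $f$: $f:[0,\infty)\to[0,\infty)$ is continuous, $f(0)=0$, $f$ has exactly one positive equilibrium (fixed point) $K>0$, which is locally unstable (not Lyapunov stable) for $x_{n+1}=f(x_n)$; $f(x)>x$ for $x\in(0,K)$ and $0<f(x)<x$ for $x\in(K,\infty)$. Moreover $f$ is unimodal and three times differentiable, with a unique critical point $c\in(0,K)$, which is a maximum, $f'(0)>1$, $f''(x)<0$ for all $x\in(0,c)$, and the Schwarzian derivative $$(Sf)(x)=\frac{f'''(x)}{f'(x)}-\frac32\left(\frac{f''(x)}{f'(x)}\right)^2$$ is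 negative on $(0,\infty)\setminus\{c\}$. *)

theory Defs
  imports "HOL-Probability.Probability"
begin

text \<open>
  Maps \<open>f : [0,\<infinity>) \<rightarrow> [0,\<infinity>)\<close> are rendered as functions \<open>real \<Rightarrow> real\<close> whose values at negative
  arguments are irrelevant. Accordingly all derivatives are taken within \<open>[0,\<infinity>)\<close>: the derivative
  is one-sided at \<open>0\<close> and the ordinary one at every \<open>x > 0\<close>. The second and third derivatives
  are iterates of this operator.
\<close>

definition D :: "(real \<Rightarrow> real) \<Rightarrow> real \<Rightarrow> real" where
  "D f x = vector_derivative f (at x within {0..})"

definition three_times_differentiable :: "(real \<Rightarrow> real) \<Rightarrow> bool" where
  "three_times_differentiable f \<longleftrightarrow>
     f differentiable_on {0..} \<and> D f differentiable_on {0..} \<and> D (D f) differentiable_on {0..}"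

definition schwarzian :: "(real \<Rightarrow> real) \<Rightarrow> real \<Rightarrow> real" where
  "schwarzian f x = D (D (D f)) x / D f x - 3 / 2 * (D (D f) x / D f x)\<^sup>2"

definition lyapunov_stable :: "(real \<Rightarrow> real) \<Rightarrow> real \<Rightarrow> bool" where
  "lyapunov_stable f K \<longleftrightarrow>
     (\<forall>\<epsilon>>0. \<exists>\<delta>>0. \<forall>x\<^sub>0\<ge>0. \<bar>x\<^sub>0 - K\<bar> < \<delta> \<longrightarrow> (\<forall>n. \<bar>(f ^^ n) x\<^sub>0 - K\<bar> < \<epsilon>))"

definition unimodal :: "(real \<Rightarrow> real) \<Rightarrow> real \<Rightarrow> bool" where
  "unimodal f c \<longleftrightarrow> strict_mono_on {0..c} f \<and> strict_antimono_on {c..} f"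

definition assumption_C :: "(real \<Rightarrow> real) \<Rightarrow> real \<Rightarrow> real \<Rightarrow> bool" where
  "assumption_C f K c \<longleftrightarrow>
     (\<forall>x\<ge>0. f x \<ge> 0) \<and> continuous_on {0..} f \<and> f 0 = 0 \<and>
     K > 0 \<and> (\<forall>x>0. f x = x \<longleftrightarrow> x = K) \<and> \<not> lyapunov_stable f K \<and>
     (\<forall>x\<in>{0<..<K}. f x > x) \<and> (\<forall>x\<in>{K<..}. 0 < f x \<and> f x < x) \<and>
     three_times_differentiable f \<and>
     c \<in> {0<..<K} \<and> unimodal f c \<and>
     (\<forall>x\<ge>0. D f x = 0 \<longleftrightarrow> x = c) \<and> (\<forall>x\<ge>0. f x \<le> f c) \<and>
     D f 0 > 1 \<and> (\<forall>x\<in>{0<..<c}. D (D f) x < 0) \<and>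
     (\<forall>x\<in>{0<..} - {c}. schwarzian f x < 0)"

definition noise_assumption :: "'a measure \<Rightarrow> (nat \<Rightarrow> 'a \<Rightarrow> real) \<Rightarrow> bool" where
  "noise_assumption M \<xi> \<longleftrightarrow>
     prob_space M \<and>
     prob_space.indep_vars M (\<lambda>_. borel) \<xi> UNIV \<and>
     (\<forall>m n. distr M borel (\<xi> m) = distr M borel (\<xi> n)) \<and>
     (\<forall>n. \<forall>\<omega>\<in>space M. \<bar>\<xi> n \<omega>\<bar> \<le> 1) \<and>
     (\<forall>n. \<forall>\<epsilon>>0. measure M {\<omega>\<in>space M. \<xi> n \<omega> \<in> {1 - \<epsilon><..1}} > 0)"

definition symmetric_distribution :: "'a measure \<Rightarrow> ('a \<Rightarrow> real) \<Rightarrow> bool" where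
  "symmetric_distribution M X \<longleftrightarrow> distr M borel (\<lambda>\<omega>. - X \<omega>) = distr M borel X"

definition has_density :: "'a measure \<Rightarrow> ('a \<Rightarrow> real) \<Rightarrow> bool" where
  "has_density M X \<longleftrightarrow> (\<exists>g. distributed M lborel X g)"

definition discrete_countable :: "'a measure \<Rightarrow> ('a \<Rightarrow> real) \<Rightarrow> bool" where
  "discrete_countable M X \<longleftrightarrow> (\<exists>S. countable S \<and> (AE \<omega> in M. X \<omega> \<in> S))"

end

theory Submission
  imports Defs
begin

text \<open>
  The argument of the logarithm is \<open>a - b \<xi>\<close> with \<open>a = L\<^sub>0 - (L\<^sub>0 + 1) \<alpha>\<close> and \<open>b = (L\<^sub>0 + 1) l\<close>, and
  \<open>\<alpha> = \<alpha>\<^sub>0\<close> corresponds exactly to \<open>a = 1\<close>. By symmetry of the noise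
  \<open>E ln (a - b \<xi>) = 1/2 E ln (a\<^sup>2 - b\<^sup>2 \<xi>\<^sup>2)\<close>, and \<open>ln u \<le> u - 1\<close> bounds this by
  \<open>(a\<^sup>2 - 1 - b\<^sup>2 E \<xi>\<^sup>2) / 2\<close> (lemma \<open>symmetric_log_expectation\<close>). The noise is not almost surely zero,
  so \<open>E \<xi>\<^sup>2 > 0\<close>; hence one fixes any small admissible amplitude \<open>l > 0\<close> and then moves \<open>\<alpha>\<close> so close
  to \<open>\<alpha>\<^sub>0\<close> from below that \<open>a\<^sup>2 - 1\<close> drops below \<open>b\<^sup>2 E \<xi>\<^sup>2\<close>.

  For this choice to be possible one needs \<open>\<alpha>\<^sub>0 > 0\<close>, that is \<open>L\<^sub>0 > 1\<close>, and this is where the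
  hypotheses on \<open>f\<close> enter. As \<open>f\<close> decreases near \<open>K\<close>, every \<open>x > K\<close> near \<open>K\<close> with \<open>f (f x) \<le> x\<close> gives
  an invariant interval \<open>[f x, x]\<close> around \<open>K\<close>; so instability forces \<open>f (f x) > x\<close> for all \<open>x > K\<close>
  close to \<open>K\<close>. Comparing derivatives at \<open>K\<close> gives \<open>(f' K)\<^sup>2 \<ge> 1\<close>. In the boundary case \<open>f' K = -1\<close>
  the function \<open>f (f x) - x\<close> vanishes at \<open>K\<close> together with its first two derivatives, while its third
  derivative there is twice the Schwarzian derivative of \<open>f\<close>, hence negative. That would make it
  negative to the right of \<open>K\<close>, a contradiction.
\<close>

section \<open>Instability and the slope at the equilibrium\<close>

text \<open>
  The interval \<open>[f x, x]\<close> is invariant as soon as \<open>f (f x) \<le> x\<close>: antitonicity maps it into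
  \<open>[f x, f (f x)]\<close>. By continuity these intervals shrink to the fixed point with \<open>x\<close>.
\<close>

lemma lyapunov_stable_if_second_iterate_le:
  fixes f :: "real \<Rightarrow> real"
  assumes anti: "strict_antimono_on {c..} f" and "c < K" and fixK: "f K = K" and cont: "isCont f K"
    and ret: "\<And>\<epsilon>. \<epsilon> > 0 \<Longrightarrow> \<exists>x\<in>{K<..<K + \<epsilon>}. f (f x) \<le> x"
  shows "lyapunov_stable f K"
  unfolding lyapunov_stable_def
proof (intro allI impI)
  fix \<epsilon> :: real assume "\<epsilon> > 0"
  have "min \<epsilon> (K - c) > 0" using \<open>\<epsilon> > 0\<close> \<open>c < K\<close> by simp
  then obtain s where s: "s > 0" "\<And>x. \<bar>x - K\<bar> < s \<Longrightarrow> \<bar>f x - K\<bar> < min \<epsilon> (K - c)"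
    using cont fixK unfolding continuous_at_eps_delta dist_real_def by metis
  have "min s \<epsilon> > 0" using s \<open>\<epsilon> > 0\<close> by simp
  from ret[OF this] obtain x where x: "K < x" "x < K + s" "x < K + \<epsilon>" "f (f x) \<le> x"
    by auto
  have fx: "\<bar>f x - K\<bar> < min \<epsilon> (K - c)" using s(2)[of x] x by auto
  have dec: "f v \<le> f u" if "c \<le> u" "u \<le> v" for u v
    using monotone_onD[OF anti, of u v] that by (cases "u = v") auto
  have "f x < K"
    using monotone_onD[OF anti, of K x] x \<open>c < K\<close> fixK by auto
  have inv: "f y \<in> {f x..x}" if "y \<in> {f x..x}" for y
  proof -
    have "c \<le> f x" using fx by linarith
    with that have "f x \<le> f y" "f y \<le> f (f x)" using dec[of y x] dec[of "f x" y] by auto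
    then show ?thesis using x(4) by auto
  qed
  show "\<exists>\<delta>>0. \<forall>x\<^sub>0\<ge>0. \<bar>x\<^sub>0 - K\<bar> < \<delta> \<longrightarrow> (\<forall>n. \<bar>(f ^^ n) x\<^sub>0 - K\<bar> < \<epsilon>)"
  proof (intro exI[of _ "min (x - K) (K - f x)"] conjI allI impI)
    show "min (x - K) (K - f x) > 0" using x \<open>f x < K\<close> by simp
    fix y :: real and n
    assume y: "\<bar>y - K\<bar> < min (x - K) (K - f x)"
    have "(f ^^ n) y \<in> {f x..x}"
    proof (induction n)
      case 0
      show ?case using y by auto
    next
      case (Suc n)
      then show ?case using inv by simp
    qed
    then show "\<bar>(f ^^ n) y - K\<bar> < \<epsilon>" using x fx by (simp add: abs_less_iff)
  qed
qed

lemma negative_right_of_zero_if_deriv_negative: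
  fixes h h' :: "real \<Rightarrow> real"
  assumes "h K = 0"
    and "\<And>x. x \<in> {K..<K + \<epsilon>} \<Longrightarrow> (h has_real_derivative h' x) (at x)"
    and "\<And>x. x \<in> {K<..<K + \<epsilon>} \<Longrightarrow> h' x < 0"
    and x: "x \<in> {K<..<K + \<epsilon>}"
  shows "h x < 0"
proof -
  have "\<exists>z>K. z < x \<and> h x - h K = (x - K) * h' z"
    using x by (intro MVT2 assms(2)) auto
  then obtain z where z: "K < z" "z < x" "h x - h K = (x - K) * h' z" by blast
  have "(x - K) * h' z < 0"
    using z(1,2) x assms(3)[of z] by (intro mult_pos_neg) auto
  then show ?thesis using z assms(1) by simp
qed

text \<open>
  The third derivative is only assumed to exist at \<open>K\<close>: it makes \<open>h''\<close> negative on the right of \<open>K\<close>,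
  and the mean value theorem passes this sign down to \<open>h'\<close> and then to \<open>h\<close>.
\<close>

lemma negative_right_of_triple_zero:
  fixes h h1 h2 :: "real \<Rightarrow> real"
  assumes zero: "h K = 0" "h1 K = 0" "h2 K = 0" and "\<epsilon> > 0"
    and d1: "\<And>x. x \<in> {K..<K + \<epsilon>} \<Longrightarrow> (h has_real_derivative h1 x) (at x)"
    and d2: "\<And>x. x \<in> {K..<K + \<epsilon>} \<Longrightarrow> (h1 has_real_derivative h2 x) (at x)"
    and d3: "(h2 has_real_derivative d) (at K)" "d < 0"
  shows "\<exists>\<delta>>0. \<forall>x\<in>{K<..<K + \<delta>}. h x < 0"
proof -
  obtain s where s: "s > 0" "\<And>t. 0 < t \<Longrightarrow> t < s \<Longrightarrow> h2 (K + t) < h2 K"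
    using DERIV_neg_dec_right[OF d3] by blast
  define \<delta> where "\<delta> = min s \<epsilon>"
  have "h2 x < 0" if "x \<in> {K<..<K + \<delta>}" for x
    using s(2)[of "x - K"] that zero by (auto simp: \<delta>_def)
  then have "h1 x < 0" if "x \<in> {K<..<K + \<delta>}" for x
    by (intro negative_right_of_zero_if_deriv_negative[of h1 K \<delta> h2] zero d2 that)
      (auto simp: \<delta>_def)
  then have "h x < 0" if "x \<in> {K<..<K + \<delta>}" for x
    by (intro negative_right_of_zero_if_deriv_negative[of h K \<delta> h1] zero d1 that)
      (auto simp: \<delta>_def)
  moreover have "\<delta> > 0" using s \<open>\<epsilon> > 0\<close> by (simp add: \<delta>_def)
  ultimately show ?thesis by blast
qed

text \<open>
  At a fixed point of slope \<open>-1\<close> the third derivative of \<open>f \<circ> f\<close> is \<open>- 2 f''' - 3 f''\<^sup>2\<close>, twice the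
  Schwarzian derivative of \<open>f\<close>; its sign decides on which side of the diagonal \<open>f \<circ> f\<close> lies.
\<close>

lemma second_iterate_below_diagonal:
  fixes f f1 f2 :: "real \<Rightarrow> real"
  assumes fixK: "f K = K" and slope: "f1 K = -1" and "\<epsilon> > 0"
    and d1: "\<And>x. \<bar>x - K\<bar> < \<epsilon> \<Longrightarrow> (f has_real_derivative f1 x) (at x)"
    and d2: "\<And>x. \<bar>x - K\<bar> < \<epsilon> \<Longrightarrow> (f1 has_real_derivative f2 x) (at x)"
    and d3: "(f2 has_real_derivative f3) (at K)"
    and schwarz: "f3 / f1 K - 3 / 2 * (f2 K / f1 K)\<^sup>2 < 0"
  shows "\<exists>\<delta>>0. \<forall>x\<in>{K<..<K + \<delta>}. f (f x) < x"
proof -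
  have "isCont f K" using d1[of K] \<open>\<epsilon> > 0\<close> by (auto intro: DERIV_isCont)
  then obtain s where s: "s > 0" "\<And>x. \<bar>x - K\<bar> < s \<Longrightarrow> \<bar>f x - K\<bar> < \<epsilon>"
    using fixK \<open>\<epsilon> > 0\<close> unfolding continuous_at_eps_delta dist_real_def by metis
  have near: "\<bar>x - K\<bar> < \<epsilon> \<and> \<bar>f x - K\<bar> < \<epsilon>" if "x \<in> {K..<K + min s \<epsilon>}" for x
    using that s(2)[of x] by auto
  have c0: "((\<lambda>x. f (f x) - x) has_real_derivative f1 (f x) * f1 x - 1) (at x)"
    if "x \<in> {K..<K + min s \<epsilon>}" for x
    using near[OF that]
    by (auto intro!: derivative_eq_intros DERIV_chain2[where f = f and g = f] d1)
  have c1: "((\<lambda>x. f1 (f x) * f1 x - 1) has_real_derivative f2 (f x) * (f1 x)\<^sup>2 + f1 (f x) * f2 x) (at x)"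
    if "x \<in> {K..<K + min s \<epsilon>}" for x
  proof -
    have "((\<lambda>x. f1 (f x)) has_real_derivative f2 (f x) * f1 x) (at x)"
      using near[OF that] by (intro DERIV_chain2[where f = f1 and g = f] d1 d2) auto
    from DERIV_diff[OF DERIV_mult[OF this d2[of x]] DERIV_const] near[OF that] show ?thesis
      by (simp add: power2_eq_square algebra_simps)
  qed
  have c2: "((\<lambda>x. f2 (f x) * (f1 x)\<^sup>2 + f1 (f x) * f2 x)
      has_real_derivative - 2 * f3 - 3 * (f2 K)\<^sup>2) (at K)"
  proof -
    have K: "(f has_real_derivative -1) (at K)" "(f1 has_real_derivative f2 K) (at K)"
      using d1[of K] d2[of K] slope \<open>\<epsilon> > 0\<close> by auto
    have 1: "((\<lambda>x. f2 (f x)) has_real_derivative f3 * (-1)) (at K)"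
      using K d3 fixK by (intro DERIV_chain2[where f = f2 and g = f]) auto
    have 2: "((\<lambda>x. f1 (f x)) has_real_derivative f2 K * (-1)) (at K)"
      using K fixK by (intro DERIV_chain2[where f = f1 and g = f]) auto
    show ?thesis
      by (rule derivative_eq_intros 1 2 K d3 refl)+
        (simp add: fixK slope power2_eq_square algebra_simps)
  qed
  have "- 2 * f3 - 3 * (f2 K)\<^sup>2 < 0" using schwarz slope by simp
  moreover have "min s \<epsilon> > 0" using s \<open>\<epsilon> > 0\<close> by simp
  ultimately show ?thesis
    using negative_right_of_triple_zero[where \<epsilon> = "min s \<epsilon>", OF _ _ _ _ c0 c1 c2] fixK slope by simp
qed

lemma has_real_derivative_D:
  assumes "f differentiable_on {0..}" and "x > 0"
  shows "(f has_real_derivative D f x) (at x)"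
proof -
  have *: "at x within {0..} = at x"
    using \<open>x > 0\<close> by (intro at_within_interior) (simp add: interior_real_atLeast)
  have "f differentiable at x"
    using assms * by (metis atLeast_iff differentiable_on_def less_imp_le)
  then show ?thesis
    unfolding D_def * has_real_derivative_iff_has_vector_derivative
    by (rule vector_derivative_works[THEN iffD1])
qed

text \<open>
  Instability excludes \<open>f (f x) \<le> x\<close> immediately to the right of \<open>K\<close>, whereas slopes in
  \<open>(-1,0]\<close>, and by the Schwarzian condition also slope \<open>-1\<close>, would produce it.
\<close>

proposition slope_at_equilibrium:
  assumes C: "assumption_C f K c"
  shows "- D f K > 1"
proof (rule ccontr)
  assume "\<not> - D f K > 1"
  from C have cK: "0 < c" "c < K" "K > 0" and fixK: "f K = K" and anti: "strict_antimono_on {c..} f"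
    and unstable: "\<not> lyapunov_stable f K" and diff: "three_times_differentiable f"
    and schwarz: "schwarzian f K < 0"
    by (auto simp: assumption_C_def unimodal_def)
  have d1: "(f has_real_derivative D f x) (at x)"
    and d2: "(D f has_real_derivative D (D f) x) (at x)"
    and d3: "(D (D f) has_real_derivative D (D (D f)) x) (at x)" if "x > 0" for x
    using diff that by (auto simp: three_times_differentiable_def intro: has_real_derivative_D)
  have "isCont f K" using d1[OF \<open>K > 0\<close>] by (rule DERIV_isCont)
  then obtain \<epsilon> where \<epsilon>: "\<epsilon> > 0" "\<And>x. x \<in> {K<..<K + \<epsilon>} \<Longrightarrow> f (f x) > x"
    using lyapunov_stable_if_second_iterate_le[OF anti \<open>c < K\<close> fixK] unstable
    by (metis linorder_not_le)
  have "D f K \<le> 0"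
  proof (rule ccontr)
    assume "\<not> D f K \<le> 0"
    then obtain s where "s > 0" "\<And>t. 0 < t \<Longrightarrow> t < s \<Longrightarrow> f K < f (K + t)"
      using DERIV_pos_inc_right[OF d1[OF \<open>K > 0\<close>]] by auto
    then have "f K < f (K + s / 2)" by simp
    moreover have "f (K + s / 2) < f K"
      using monotone_onD[OF anti, of K "K + s / 2"] cK \<open>s > 0\<close> by auto
    ultimately show False by simp
  qed
  have h: "((\<lambda>x. f (f x) - x) has_real_derivative D f K * D f K - 1) (at K)"
  proof -
    have "((\<lambda>x. f (f x)) has_real_derivative D f K * D f K) (at K)"
      using d1[OF \<open>K > 0\<close>] fixK by (intro DERIV_chain2[where f = f and g = f]) auto
    then show ?thesis by (auto intro!: derivative_eq_intros)
  qed
  have "D f K * D f K - 1 \<ge> 0"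
  proof (rule ccontr)
    assume "\<not> D f K * D f K - 1 \<ge> 0"
    then obtain s where s: "s > 0" "\<And>t. 0 < t \<Longrightarrow> t < s \<Longrightarrow> f (f (K + t)) - (K + t) < f (f K) - K"
      using DERIV_neg_dec_right[OF h] by auto
    define t where "t = min s \<epsilon> / 2"
    have "0 < t" "t < s" "t < \<epsilon>" using s(1) \<epsilon>(1) by (auto simp: t_def min_def)
    then show False using s(2)[of t] \<epsilon>(2)[of "K + t"] fixK by simp
  qed
  then have "D f K = -1"
    using \<open>D f K \<le> 0\<close> \<open>\<not> - D f K > 1\<close> abs_le_square_iff[of 1 "D f K"]
    by (simp add: power2_eq_square)
  \<comment> \<open>The radius \<open>K\<close> keeps the neighbourhood inside \<open>(0,\<infinity>)\<close>, where \<open>D\<close> is the two-sided derivative.\<close>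
  have "\<exists>\<delta>>0. \<forall>x\<in>{K<..<K + \<delta>}. f (f x) < x"
    using schwarz cK
    by (intro second_iterate_below_diagonal[where ?f1.0 = "D f" and ?f2.0 = "D (D f)" and \<epsilon> = K
          and ?f3.0 = "D (D (D f)) K"] d1 d2 d3 fixK \<open>D f K = -1\<close>)
      (auto simp: schwarzian_def)
  then obtain \<delta> where \<delta>: "\<delta> > 0" "\<And>x. x \<in> {K<..<K + \<delta>} \<Longrightarrow> f (f x) < x" by blast
  define t where "t = min \<delta> \<epsilon> / 2"
  have "0 < t" "t < \<delta>" "t < \<epsilon>" using \<delta>(1) \<epsilon>(1) by (auto simp: t_def min_def)
  then show False using \<delta>(2)[of "K + t"] \<epsilon>(2)[of "K + t"] by simp
qed

section \<open>The logarithmic expectation of symmetric noise\<close>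

text \<open>
  Averaging \<open>ln (a - b X)\<close> with \<open>ln (a + b X)\<close>, which has the same expectation, removes the
  first-order term in \<open>X\<close>; only the negative quadratic one remains.
\<close>

lemma symmetric_log_expectation:
  fixes a b :: real
  assumes "prob_space M" and X: "X \<in> borel_measurable M"
    and bound: "\<And>\<omega>. \<omega> \<in> space M \<Longrightarrow> \<bar>X \<omega>\<bar> \<le> 1"
    and sym: "symmetric_distribution M X" and ab: "0 \<le> b" "b < a"
  shows "integrable M (\<lambda>\<omega>. ln (a - b * X \<omega>))"
    and "(\<integral>\<omega>. ln (a - b * X \<omega>) \<partial>M) \<le> (a\<^sup>2 - 1 - b\<^sup>2 * (\<integral>\<omega>. (X \<omega>)\<^sup>2 \<partial>M)) / 2"
proof -
  interpret prob_space M by fact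
  have bX: "\<bar>b * X \<omega>\<bar> \<le> b" if "\<omega> \<in> space M" for \<omega>
    using mult_left_le[OF bound[OF that] ab(1)] ab(1) by (simp add: abs_mult)
  have int: "integrable M (\<lambda>\<omega>. ln (a - s * b * X \<omega>))" if "s \<in> {1, -1}" for s :: real
  proof (rule integrable_const_bound[where B = "\<bar>ln (a - b)\<bar> + \<bar>ln (a + b)\<bar>"])
    show "AE \<omega> in M. norm (ln (a - s * b * X \<omega>)) \<le> \<bar>ln (a - b)\<bar> + \<bar>ln (a + b)\<bar>"
    proof (rule AE_I2)
      fix \<omega> assume "\<omega> \<in> space M"
      then have *: "a - b \<le> a - s * b * X \<omega>" "a - s * b * X \<omega> \<le> a + b" "0 < a - b"
        using bX[of \<omega>] that ab by auto
      then have "ln (a - b) \<le> ln (a - s * b * X \<omega>)" "ln (a - s * b * X \<omega>) \<le> ln (a + b)"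
        by (intro ln_mono; linarith)+
      then show "norm (ln (a - s * b * X \<omega>)) \<le> \<bar>ln (a - b)\<bar> + \<bar>ln (a + b)\<bar>" by simp
    qed
  qed (use X in measurable)
  from int[of 1] show minus: "integrable M (\<lambda>\<omega>. ln (a - b * X \<omega>))" by simp
  from int[of "-1"] have plus: "integrable M (\<lambda>\<omega>. ln (a + b * X \<omega>))" by simp
  have sq: "integrable M (\<lambda>\<omega>. (X \<omega>)\<^sup>2)"
    using X bound by (intro integrable_const_bound[where B = 1] AE_I2) (auto simp: abs_square_le_1)
  have "(\<integral>\<omega>. ln (a - b * X \<omega>) \<partial>M) = (\<integral>x. ln (a - b * x) \<partial>distr M borel X)"
    using X by (simp add: integral_distr)
  also have "\<dots> = (\<integral>x. ln (a - b * x) \<partial>distr M borel (\<lambda>\<omega>. - X \<omega>))"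
    using sym by (simp add: symmetric_distribution_def)
  also have "\<dots> = (\<integral>\<omega>. ln (a + b * X \<omega>) \<partial>M)"
    using X by (simp add: integral_distr)
  finally have "2 * (\<integral>\<omega>. ln (a - b * X \<omega>) \<partial>M) = (\<integral>\<omega>. ln (a - b * X \<omega>) + ln (a + b * X \<omega>) \<partial>M)"
    using minus plus by simp
  also have "\<dots> \<le> (\<integral>\<omega>. a\<^sup>2 - 1 - b\<^sup>2 * (X \<omega>)\<^sup>2 \<partial>M)"
  proof (rule integral_mono)
    fix \<omega> assume "\<omega> \<in> space M"
    then have pos: "0 < a - b * X \<omega>" "0 < a + b * X \<omega>" using bX[of \<omega>] ab by auto
    then have "ln (a - b * X \<omega>) + ln (a + b * X \<omega>) = ln ((a - b * X \<omega>) * (a + b * X \<omega>))"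
      by (simp add: ln_mult)
    also have "\<dots> \<le> (a - b * X \<omega>) * (a + b * X \<omega>) - 1"
      using pos by (intro ln_le_minus_one mult_pos_pos)
    also have "\<dots> = a\<^sup>2 - 1 - b\<^sup>2 * (X \<omega>)\<^sup>2" by (simp add: power2_eq_square algebra_simps)
    finally show "ln (a - b * X \<omega>) + ln (a + b * X \<omega>) \<le> a\<^sup>2 - 1 - b\<^sup>2 * (X \<omega>)\<^sup>2" .
  qed (use minus plus sq in auto)
  also have "\<dots> = a\<^sup>2 - 1 - b\<^sup>2 * (\<integral>\<omega>. (X \<omega>)\<^sup>2 \<partial>M)"
    using sq by (simp add: prob_space)
  finally show "(\<integral>\<omega>. ln (a - b * X \<omega>) \<partial>M) \<le> (a\<^sup>2 - 1 - b\<^sup>2 * (\<integral>\<omega>. (X \<omega>)\<^sup>2 \<partial>M)) / 2"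
    by simp
qed

lemma second_moment_pos:
  fixes X :: "'a \<Rightarrow> real"
  assumes "prob_space M" and X: "X \<in> borel_measurable M"
    and bound: "\<And>\<omega>. \<omega> \<in> space M \<Longrightarrow> \<bar>X \<omega>\<bar> \<le> 1"
    and pos: "measure M {\<omega> \<in> space M. X \<omega> \<in> {0<..1}} > 0"
  shows "(\<integral>\<omega>. (X \<omega>)\<^sup>2 \<partial>M) > 0"
proof -
  interpret prob_space M by fact
  have sq: "integrable M (\<lambda>\<omega>. (X \<omega>)\<^sup>2)"
    using X bound by (intro integrable_const_bound[where B = 1] AE_I2) (auto simp: abs_square_le_1)
  have "(\<integral>\<omega>. (X \<omega>)\<^sup>2 \<partial>M) \<noteq> 0"
  proof
    assume "(\<integral>\<omega>. (X \<omega>)\<^sup>2 \<partial>M) = 0"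
    then have "AE \<omega> in M. X \<omega> = 0"
      using integral_nonneg_eq_0_iff_AE[OF sq] by simp
    then have "AE \<omega> in M. \<omega> \<notin> {\<omega> \<in> space M. X \<omega> \<in> {0<..1}}" by eventually_elim simp
    then have "measure M {\<omega> \<in> space M. X \<omega> \<in> {0<..1}} = 0"
      using X by (subst prob_eq_0) measurable
    with pos show False by simp
  qed
  moreover have "(\<integral>\<omega>. (X \<omega>)\<^sup>2 \<partial>M) \<ge> 0" by simp
  ultimately show ?thesis by linarith
qed

section \<open>Choice of the control parameters\<close>

text \<open>
  With \<open>a = 1 + \<eta>\<close>, that is \<open>\<alpha> = \<alpha>\<^sub>0 - \<eta> / (L + 1)\<close>, all conditions hold for fixed small \<open>l\<close> once
  \<open>\<eta>\<close> is small, because \<open>a\<^sup>2 - 1 \<le> 3 \<eta>\<close> for \<open>\<eta> \<le> 1\<close>.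
\<close>

lemma control_parameters:
  fixes L v :: real
  assumes "L > 1" and "v > 0"
  defines "\<alpha>\<^sub>0 \<equiv> (L - 1) / (L + 1)"
  obtains \<alpha> l where "0 < \<alpha>" "\<alpha> < \<alpha>\<^sub>0" "\<alpha>\<^sub>0 - \<alpha> < l" "0 < l" "l < \<alpha>" "l < 1 - \<alpha>"
    "\<alpha> + l < L / (L + 1)"
    "(L - (L + 1) * \<alpha>)\<^sup>2 - 1 - ((L + 1) * l)\<^sup>2 * v < 0"
proof -
  \<comment> \<open>The bounds \<open>l < \<alpha>\<^sub>0\<close> and \<open>l < 1 / (L + 1)\<close> imply all constraints on \<open>l\<close> at \<open>\<alpha> = \<alpha>\<^sub>0\<close>, as
    \<open>L / (L + 1) - \<alpha>\<^sub>0 = 1 / (L + 1)\<close>; halving leaves room for the shift of \<open>\<alpha>\<close>, which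
    \<open>\<eta> \<le> b / 4\<close> bounds by \<open>l / 4\<close>.\<close>
  define l where "l = min \<alpha>\<^sub>0 (1 / (L + 1)) / 2"
  define b where "b = (L + 1) * l"
  define \<eta> where "\<eta> = min 1 (min b (b\<^sup>2 * v)) / 4"
  define \<alpha> where "\<alpha> = \<alpha>\<^sub>0 - \<eta> / (L + 1)"
  have L: "L + 1 > 0" using \<open>L > 1\<close> by simp
  have \<alpha>\<^sub>0: "\<alpha>\<^sub>0 > 0" and split: "\<alpha>\<^sub>0 + 1 / (L + 1) = L / (L + 1)"
    using \<open>L > 1\<close> by (simp_all add: \<alpha>\<^sub>0_def add_divide_distrib[symmetric])
  have "0 < 1 / (L + 1)" using L by simp
  then have l: "0 < l" "l \<le> \<alpha>\<^sub>0 / 2" "l < 1 / (L + 1)" using \<alpha>\<^sub>0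
    by (auto simp: l_def min_def simp del: zero_less_divide_1_iff)
  have b: "b > 0" using l L by (simp add: b_def)
  have \<eta>: "0 < \<eta>" "\<eta> \<le> 1 / 4" "\<eta> \<le> b / 4" "\<eta> \<le> b\<^sup>2 * v / 4"
    using b \<open>v > 0\<close> by (auto simp: \<eta>_def)
  have shift: "0 < \<eta> / (L + 1)" "\<eta> / (L + 1) \<le> l / 4"
    using \<eta> L by (auto simp: field_simps b_def)
  have "L / (L + 1) < 1" using L by simp
  show ?thesis
  proof (rule that[of \<alpha> l])
    have "(L + 1) * \<alpha>\<^sub>0 = L - 1" using L by (simp add: \<alpha>\<^sub>0_def)
    then have "L - (L + 1) * \<alpha> = 1 + \<eta>"
      using L by (simp add: \<alpha>_def right_diff_distrib)
    then have "(L - (L + 1) * \<alpha>)\<^sup>2 - 1 = \<eta> * (2 + \<eta>)"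
      by (simp only:) (simp add: power2_eq_square algebra_simps)
    also have "\<dots> \<le> \<eta> * 3" using \<eta> by (intro mult_left_mono) auto
    also have "\<dots> < b\<^sup>2 * v" using \<eta> by linarith
    finally show "(L - (L + 1) * \<alpha>)\<^sup>2 - 1 - ((L + 1) * l)\<^sup>2 * v < 0" by (simp add: b_def)
  qed (use shift l \<alpha>\<^sub>0 split \<open>L / (L + 1) < 1\<close> in \<open>unfold \<alpha>_def, linarith+\<close>)
qed

theorem theorem5:
  fixes f :: "real \<Rightarrow> real" and K c L\<^sub>0 \<alpha>\<^sub>0 :: real
    and M :: "'a measure" and \<xi> :: "nat \<Rightarrow> 'a \<Rightarrow> real"
  assumes "assumption_C f K c"
    and "noise_assumption M \<xi>"
    and "L\<^sub>0 = - D f K"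
    and "\<alpha>\<^sub>0 = (- D f K - 1) / (- D f K + 1)"
    and "\<forall>n. symmetric_distribution M (\<xi> n)"
    and "(\<forall>n. has_density M (\<xi> n)) \<or> (\<forall>n. discrete_countable M (\<xi> n))"
  shows "\<exists>\<alpha>\<in>{0<..<\<alpha>\<^sub>0}. \<exists>l\<in>{\<alpha>\<^sub>0 - \<alpha><..<min \<alpha> (1 - \<alpha>)}.
           \<alpha>\<^sub>0 < \<alpha> + l \<and> \<alpha> + l < L\<^sub>0 / (L\<^sub>0 + 1) \<and>
           (\<forall>n. integrable M (\<lambda>\<omega>. ln ((1 - \<alpha> - l * \<xi> n \<omega>) * L\<^sub>0 - \<alpha> - l * \<xi> n \<omega>)) \<and>
                prob_space.expectation M (\<lambda>\<omega>. ln ((1 - \<alpha> - l * \<xi> n \<omega>) * L\<^sub>0 - \<alpha> - l * \<xi> n \<omega>)) < 0)"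
proof -
  have prob: "prob_space M"
    and indep: "prob_space.indep_vars M (\<lambda>_. borel) \<xi> UNIV"
    and ident: "\<And>m n. distr M borel (\<xi> m) = distr M borel (\<xi> n)"
    and bound: "\<And>n \<omega>. \<omega> \<in> space M \<Longrightarrow> \<bar>\<xi> n \<omega>\<bar> \<le> 1"
    and top: "\<And>n \<epsilon>. \<epsilon> > 0 \<Longrightarrow> measure M {\<omega>\<in>space M. \<xi> n \<omega> \<in> {1 - \<epsilon><..1}} > 0"
    using assms(2) by (auto simp: noise_assumption_def)
  have meas: "\<xi> n \<in> borel_measurable M" for n
    using indep prob_space.indep_vars_def2[OF prob, of "\<lambda>_. borel" \<xi> UNIV] by simp
  define v where "v = (\<integral>\<omega>. (\<xi> 0 \<omega>)\<^sup>2 \<partial>M)"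
  have v: "(\<integral>\<omega>. (\<xi> n \<omega>)\<^sup>2 \<partial>M) = v" for n
  proof -
    have "(\<integral>\<omega>. (\<xi> m \<omega>)\<^sup>2 \<partial>M) = (\<integral>x. x\<^sup>2 \<partial>distr M borel (\<xi> m))" for m
      using meas by (simp add: integral_distr)
    then show ?thesis using ident[of n 0] by (simp add: v_def)
  qed
  have "v > 0"
    using second_moment_pos[OF prob meas[of 0] bound] top[of 1 0] by (simp add: v_def)
  have L: "L\<^sub>0 > 1" using slope_at_equilibrium[OF assms(1)] assms(3) by simp
  have \<alpha>\<^sub>0: "\<alpha>\<^sub>0 = (L\<^sub>0 - 1) / (L\<^sub>0 + 1)" using assms(3,4) by simp
  obtain \<alpha> l where par: "0 < \<alpha>" "\<alpha> < \<alpha>\<^sub>0" "\<alpha>\<^sub>0 - \<alpha> < l" "0 < l" "l < \<alpha>" "l < 1 - \<alpha>"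
      "\<alpha> + l < L\<^sub>0 / (L\<^sub>0 + 1)"
    and neg: "(L\<^sub>0 - (L\<^sub>0 + 1) * \<alpha>)\<^sup>2 - 1 - ((L\<^sub>0 + 1) * l)\<^sup>2 * v < 0"
    using control_parameters[OF L \<open>v > 0\<close>] unfolding \<alpha>\<^sub>0 by metis
  let ?a = "L\<^sub>0 - (L\<^sub>0 + 1) * \<alpha>" and ?b = "(L\<^sub>0 + 1) * l"
  have "0 \<le> ?b" "?b < ?a" using par L by (simp_all add: field_simps)
  have rewr: "(1 - \<alpha> - l * x) * L\<^sub>0 - \<alpha> - l * x = ?a - ?b * x" for x
    by (simp add: algebra_simps)
  have "integrable M (\<lambda>\<omega>. ln (?a - ?b * \<xi> n \<omega>)) \<and> (\<integral>\<omega>. ln (?a - ?b * \<xi> n \<omega>) \<partial>M) < 0" for n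
    using symmetric_log_expectation[OF prob meas[of n] bound assms(5)[rule_format, of n] \<open>0 \<le> ?b\<close> \<open>?b < ?a\<close>]
      neg v[of n] by simp
  then show ?thesis
    using par by - (rule bexI[of _ \<alpha>], rule bexI[of _ l], simp_all add: rewr)
qed

end
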